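(* Let $\mathbb{k}$ be a field. If $\mathscr{P}$ is a finite lattice and $I\subseteq\mathscr{P}$ is a spread, then $\mathcal{N}^{\mathrm{sign.barc.}}(\mathbb{k}_I)=\chi(\Delta(I))$.
   Context: A spread of a poset $\mathscr{P}$ is a non-empty subset $I$ that is poset-connected (any two elements are joined by a sequence in $I$ whose consecutive elements are comparable) and poset-convex ($x\le y\le z$ with $x,z\in I$ implies $y\in I$). The spread representation $\mathbb{k}_I:\mathscr{P}\to\mathrm{vec}$ is $\mathbb{k}$ on $I$, $0$ elsewhere, with identity structure maps within $I$. Segments are the spreads $[x,y]=\{z:x\le z\le y\}$ for $x\le y$. The rank invariant of a functor $M:\mathscr{P}\to\mathrm{vec}$ is $\mathrm{Rk}(M)([x,y])=\mathrm{rank}(M_x\to M_y)$. For $\mathscr{P}$ finite, for each $M$ there are unique integers $c^M_{J}$, indexed by segments $J$, with $\mathrm{Rk}(M)=\sum_J c^M_J\,\mathrm{Rk}(\mathbb{k}_J)$, and $\mathcal{N}^{\mathrm{sign.barc.}}(M)=\sum_J c_J^M$. $\Delta(I)$ is the order complex of $I$ (simplicial complex of finite non-empty chains of $I$) and $\chi$ is the Euler characteristic. *)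

theory Defs
  imports "HOL-Analysis.Analysis"
begin

definition poset_connected :: "'p::order set \<Rightarrow> bool" where
  "poset_connected I \<longleftrightarrow>
     (\<forall>x\<in>I. \<forall>y\<in>I. (x, y) \<in> {(a, b). a \<in> I \<and> b \<in> I \<and> (a \<le> b \<or> b \<le> a)}\<^sup>*)"

definition poset_convex :: "'p::order set \<Rightarrow> bool" where
  "poset_convex I \<longleftrightarrow> (\<forall>x y z. x \<in> I \<longrightarrow> z \<in> I \<longrightarrow> x \<le> y \<longrightarrow> y \<le> z \<longrightarrow> y \<in> I)"

definition spread :: "'p::order set \<Rightarrow> bool" where
  "spread I \<longleftrightarrow> I \<noteq> {} \<and> poset_connected I \<and> poset_convex I"

definition segments :: "'p::order set set" where
  "segments = {{x..y} | x y. x \<le> y}"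

text \<open>
  The vector space at a point is a linear subspace of an ambient vector space \<open>'v\<close> whose scalar
  multiplication \<open>sc\<close> is passed explicitly. The map \<open>hom M x y\<close> is
  meaningful only for \<open>x \<le> y\<close> and only on \<open>space_at M x\<close>.
\<close>

record ('p, 'v) poset_rep =
  space_at :: "'p \<Rightarrow> 'v set"
  hom :: "'p \<Rightarrow> 'p \<Rightarrow> 'v \<Rightarrow> 'v"

definition representation ::
    "('k::field \<Rightarrow> 'v::ab_group_add \<Rightarrow> 'v) \<Rightarrow> ('p::order, 'v) poset_rep \<Rightarrow> bool" where
  "representation sc M \<longleftrightarrow>
     vector_space sc \<and>
     (\<forall>x. module.subspace sc (space_at M x)) \<and>
     (\<forall>x. \<exists>B. finite B \<and> module.span sc B = space_at M x) \<and>
     (\<forall>x y. x \<le> y \<longrightarrow> hom M x y ` space_at M x \<subseteq> space_at M y) \<and>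
     (\<forall>x y. x \<le> y \<longrightarrow> (\<forall>u\<in>space_at M x. \<forall>v\<in>space_at M x.
        hom M x y (u + v) = hom M x y u + hom M x y v)) \<and>
     (\<forall>x y. x \<le> y \<longrightarrow> (\<forall>c. \<forall>v\<in>space_at M x.
        hom M x y (sc c v) = sc c (hom M x y v))) \<and>
     (\<forall>x. \<forall>v\<in>space_at M x. hom M x x v = v) \<and>
     (\<forall>x y z. x \<le> y \<longrightarrow> y \<le> z \<longrightarrow> (\<forall>v\<in>space_at M x.
        hom M y z (hom M x y v) = hom M x z v))"

definition spread_rep :: "'p::order set \<Rightarrow> ('p, 'k::field) poset_rep" where
  "spread_rep I =
     \<lparr>space_at = (\<lambda>x. if x \<in> I then UNIV else {0}),
      hom = (\<lambda>x y v. if x \<in> I \<and> y \<in> I then v else 0)\<rparr>"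

text \<open>The value of the rank invariant at the segment \<open>{x..y}\<close>, for \<open>x \<le> y\<close>.\<close>

definition rank_inv ::
    "('k::field \<Rightarrow> 'v::ab_group_add \<Rightarrow> 'v) \<Rightarrow> ('p::order, 'v) poset_rep \<Rightarrow> 'p \<Rightarrow> 'p \<Rightarrow> nat" where
  "rank_inv sc M x y = vector_space.dim sc (hom M x y ` space_at M x)"

text \<open>
  The coefficients form a function on segments; it is extended by \<open>0\<close> to all sets, so that
  it is unique as a function on \<open>'p set\<close>.
\<close>

definition is_signed_barcode ::
    "('k::field \<Rightarrow> 'v::ab_group_add \<Rightarrow> 'v) \<Rightarrow> ('p::{finite,order}, 'v) poset_rep
      \<Rightarrow> ('p set \<Rightarrow> int) \<Rightarrow> bool" where
  "is_signed_barcode sc M c \<longleftrightarrow>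
     (\<forall>J. J \<notin> segments \<longrightarrow> c J = 0) \<and>
     (\<forall>x y. x \<le> y \<longrightarrow>
        int (rank_inv sc M x y) =
        (\<Sum>J\<in>segments. c J * int (rank_inv ((*) :: 'k \<Rightarrow> 'k \<Rightarrow> 'k) (spread_rep J) x y)))"

definition signed_barcode ::
    "('k::field \<Rightarrow> 'v::ab_group_add \<Rightarrow> 'v) \<Rightarrow> ('p::{finite,order}, 'v) poset_rep
      \<Rightarrow> 'p set \<Rightarrow> int" where
  "signed_barcode sc M = (THE c. is_signed_barcode sc M c)"

definition N_sign_barc ::
    "('k::field \<Rightarrow> 'v::ab_group_add \<Rightarrow> 'v) \<Rightarrow> ('p::{finite,order}, 'v) poset_rep \<Rightarrow> int" where
  "N_sign_barc sc M = (\<Sum>J\<in>segments. signed_barcode sc M J)"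

definition order_complex :: "'p::order set \<Rightarrow> 'p set set" where
  "order_complex I =
     {C. C \<subseteq> I \<and> finite C \<and> C \<noteq> {} \<and> Complete_Partial_Order.chain (\<le>) C}"

text \<open>
  For a finite simplicial complex, given as the set of its non-empty simplices; a simplex with
  \<open>n + 1\<close> vertices has dimension \<open>n\<close>.
\<close>

definition euler_char :: "'a set set \<Rightarrow> int" where
  "euler_char K = (\<Sum>\<sigma>\<in>K. (- 1) ^ (card \<sigma> - 1))"

lemma representation_spread_rep:
  assumes "poset_convex I"
  shows "representation ((*) :: 'k::field \<Rightarrow> 'k \<Rightarrow> 'k) (spread_rep I)"
proof -
  have fg: "\<exists>B. finite B \<and> module.span ((*) :: 'k \<Rightarrow> 'k \<Rightarrow> 'k) B = (if x \<in> I then UNIV else {0})"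
    for x
  proof (cases "x \<in> I")
    case True
    then show ?thesis
      by (intro exI[of _ "{1}"]) (auto simp: vector_space_over_itself.span_singleton)
  next
    case False
    then show ?thesis
      by (intro exI[of _ "{}"]) auto
  qed
  have sp: "space_at (spread_rep I) x = (if x \<in> I then UNIV else {0 :: 'k})" for x
    by (simp add: spread_rep_def)
  have hm: "hom (spread_rep I) x y v = (if x \<in> I \<and> y \<in> I then v else (0 :: 'k))" for x y v
    by (simp add: spread_rep_def)
  have sub: "module.subspace ((*) :: 'k \<Rightarrow> 'k \<Rightarrow> 'k) (if x \<in> I then UNIV else {0})" for x
    by (simp add: vector_space_over_itself.subspace_UNIV vector_space_over_itself.subspace_single_0)
  have conv: "y \<in> I" if "x \<le> y" "y \<le> z" "x \<in> I" "z \<in> I" for x y z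
    using that assms unfolding poset_convex_def by blast
  show ?thesis
    unfolding representation_def sp hm
  proof (intro conjI allI impI ballI)
    fix x y z :: 'a and v :: 'k
    assume "x \<le> y" "y \<le> z"
    then show "(if y \<in> I \<and> z \<in> I then if x \<in> I \<and> y \<in> I then v else 0 else 0) =
        (if x \<in> I \<and> z \<in> I then v else 0)"
      using conv[of x y z] by auto
  qed (use fg sub vector_space_over_itself.vector_space_axioms in \<open>auto split: if_splits\<close>)
qed

lemma rank_inv_spread_rep:
  assumes "x \<le> y"
  shows "rank_inv ((*) :: 'k::field \<Rightarrow> 'k \<Rightarrow> 'k) (spread_rep I) x y =
    (if x \<in> I \<and> y \<in> I then 1 else 0)"
proof -
  have "vector_space.dim ((*) :: 'k \<Rightarrow> 'k \<Rightarrow> 'k) UNIV = 1"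
    by (simp add: dimension_eq_1)
  moreover have "vector_space.dim ((*) :: 'k \<Rightarrow> 'k \<Rightarrow> 'k) {0} = 0"
    by simp
  moreover have "(\<lambda>v. if x \<in> I \<and> y \<in> I then v else 0) ` (if x \<in> I then UNIV else {0}) =
      (if x \<in> I \<and> y \<in> I then UNIV else {0::'k})"
    by auto
  ultimately show ?thesis
    by (simp add: rank_inv_def spread_rep_def)
qed

lemma moebius_ex:
  fixes A :: "'a set set" and f :: "'a set \<Rightarrow> int"
  assumes "finite A"
  shows "\<exists>c. \<forall>S\<in>A. f S = (\<Sum>J\<in>A. c J * (if S \<subseteq> J then 1 else 0))"
  using assms
proof (induction "card A" arbitrary: A)
  case 0
  then show ?case by simp
next
  case (Suc n)
  then have "A \<noteq> {}" by auto
  then obtain m where m: "m \<in> A" "\<And>S. S \<in> A \<Longrightarrow> S \<subseteq> m \<Longrightarrow> S = m"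
    using finite_has_minimal[OF \<open>finite A\<close>] by metis
  define B where "B = A - {m}"
  have B: "A = insert m B" "m \<notin> B" "finite B" "n = card B"
    using m Suc by (auto simp: B_def)
  obtain c where c: "\<And>S. S \<in> B \<Longrightarrow> f S = (\<Sum>J\<in>B. c J * (if S \<subseteq> J then 1 else 0))"
    using Suc.hyps(1)[OF B(4,3)] by blast
  define c' where "c' = c(m := f m - (\<Sum>J\<in>B. c J * (if m \<subseteq> J then 1 else 0)))"
  have eq: "(\<Sum>J\<in>B. c' J * (if S \<subseteq> J then 1 else 0)) =
      (\<Sum>J\<in>B. c J * (if S \<subseteq> J then 1 else 0))" for S
    by (rule sum.cong) (use B in \<open>auto simp: c'_def\<close>)
  have "f S = (\<Sum>J\<in>A. c' J * (if S \<subseteq> J then 1 else 0))" if "S \<in> A" for S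
  proof (cases "S = m")
    case True
    then show ?thesis
      using B eq[of m] by (simp add: c'_def)
  next
    case False
    then have "S \<in> B" "\<not> S \<subseteq> m" using that m B by auto
    then show ?thesis using B c eq[of S] by simp
  qed
  then show ?case by blast
qed

lemma moebius_unique:
  fixes A :: "'a set set" and d :: "'a set \<Rightarrow> int"
  assumes "finite A" and "\<And>S. S \<in> A \<Longrightarrow> (\<Sum>J\<in>A. d J * (if S \<subseteq> J then 1 else 0)) = 0" and "J \<in> A"
  shows "d J = 0"
proof (rule ccontr)
  assume "d J \<noteq> 0"
  then have "{J\<in>A. d J \<noteq> 0} \<noteq> {}" using assms by auto
  then obtain m where m: "m \<in> A" "d m \<noteq> 0" "\<And>S. S \<in> A \<Longrightarrow> d S \<noteq> 0 \<Longrightarrow> m \<subseteq> S \<Longrightarrow> S = m"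
    using finite_has_maximal[of "{J\<in>A. d J \<noteq> 0}"] assms(1) by auto
  have "(\<Sum>J\<in>A. d J * (if m \<subseteq> J then 1 else 0)) = (\<Sum>J\<in>A. if J = m then d m else 0)"
    by (rule sum.cong) (use m in auto)
  then show False
    using assms(1,2) m by simp
qed

lemma ex1_signed_barcode:
  fixes sc :: "'k::field \<Rightarrow> 'v::ab_group_add \<Rightarrow> 'v"
    and M :: "('p::{finite,order}, 'v) poset_rep"
  shows "\<exists>!c. is_signed_barcode sc M c"
proof -
  define r where "r S = int (rank_inv sc M (THE x. \<exists>y. x \<le> y \<and> S = {x..y}) (THE y. \<exists>x. x \<le> y \<and> S = {x..y}))"
    for S :: "'p set"
  have r: "r {x..y} = int (rank_inv sc M x y)" if "x \<le> y" for x y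
  proof -
    have "(THE a. \<exists>b. a \<le> b \<and> {x..y} = {a..b}) = x"
      using that by (intro the_equality) (auto simp: Icc_eq_Icc)
    moreover have "(THE b. \<exists>a. a \<le> b \<and> {x..y} = {a..b}) = y"
      using that by (intro the_equality) (auto simp: Icc_eq_Icc)
    ultimately show ?thesis by (simp add: r_def)
  qed
  have rk: "(\<Sum>J\<in>segments. c J * int (rank_inv ((*) :: 'k \<Rightarrow> 'k \<Rightarrow> 'k) (spread_rep J) x y)) =
      (\<Sum>J\<in>segments. c J * (if {x..y} \<subseteq> J then 1 else 0))" if "x \<le> y" for x y :: 'p and c
  proof (rule sum.cong)
    fix J :: "'p set" assume "J \<in> segments"
    then have "x \<in> J \<and> y \<in> J \<longleftrightarrow> {x..y} \<subseteq> J"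
      using that by (auto simp: segments_def)
    then show "c J * int (rank_inv ((*) :: 'k \<Rightarrow> 'k \<Rightarrow> 'k) (spread_rep J) x y) =
        c J * (if {x..y} \<subseteq> J then 1 else 0)"
      using that by (simp add: rank_inv_spread_rep)
  qed simp
  have iff: "is_signed_barcode sc M c \<longleftrightarrow> (\<forall>J. J \<notin> segments \<longrightarrow> c J = 0) \<and>
      (\<forall>S\<in>segments. r S = (\<Sum>J\<in>segments. c J * (if S \<subseteq> J then 1 else 0)))" for c
    unfolding is_signed_barcode_def using r rk by (auto simp: segments_def)
  have fin: "finite (segments :: 'p set set)" by simp
  obtain c where c: "\<forall>S\<in>segments. r S = (\<Sum>J\<in>segments. c J * (if S \<subseteq> J then 1 else 0))"
    using moebius_ex[OF fin] by blast
  show ?thesis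
  proof (rule ex1I)
    have "(\<Sum>J\<in>segments. (if J \<in> segments then c J else 0) * (if S \<subseteq> J then 1 else 0)) =
        (\<Sum>J\<in>segments. c J * (if S \<subseteq> J then 1 else 0))" for S
      by (rule sum.cong) auto
    then show "is_signed_barcode sc M (\<lambda>J. if J \<in> segments then c J else 0)"
      using c by (simp add: iff)
  next
    fix e assume e: "is_signed_barcode sc M e"
    show "e = (\<lambda>J. if J \<in> segments then c J else 0)"
    proof
      fix J
      show "e J = (if J \<in> segments then c J else 0)"
      proof (cases "J \<in> segments")
        case True
        have "e J - c J = 0"
        proof (rule moebius_unique[OF fin _ True])
          fix S :: "'p set" assume "S \<in> segments"
          then show "(\<Sum>J\<in>segments. (e J - c J) * (if S \<subseteq> J then 1 else 0)) = 0"
            using e c by (simp add: iff left_diff_distrib sum_subtractf)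
        qed
        then show ?thesis using True by simp
      next
        case False
        then show ?thesis using e by (simp add: iff)
      qed
    qed
  qed
qed

end

(* The coefficients c determine the Euler characteristic by additivity of the rank invariant.
   A non-empty chain C with least element a and greatest element b lies in a convex set J
   iff a and b do, that is, iff the rank of the spread representation of J at [a, b] is 1. Hence,
   with C ranging over the non-empty chains,
     chi(Delta(I)) = sum_C (-1)^(|C| - 1) Rk(k_I)([a, b])
                   = sum_J c_J sum_C (-1)^(|C| - 1) Rk(k_J)([a, b]) = sum_J c_J chi(Delta(J)),
   and chi(Delta(J)) = 1 for a segment J, because its order complex is a cone over the least
   element of J. *)

theory Submission
  imports Defs
begin

lemma poset_convex_segment: "J \<in> segments \<Longrightarrow> poset_convex J"
  by (auto simp: segments_def poset_convex_def intro: order_trans)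

lemma finite_chain_has_bounds:
  fixes C :: "'p::order set"
  assumes "finite C" and "C \<noteq> {}" and "Complete_Partial_Order.chain (\<le>) C"
  obtains a b where "a \<in> C" "b \<in> C" "C \<subseteq> {a..b}"
proof -
  obtain a where a: "a \<in> C" "\<forall>x\<in>C. x \<le> a \<longrightarrow> a = x"
    using finite_has_minimal[OF assms(1,2)] by auto
  obtain b where b: "b \<in> C" "\<forall>x\<in>C. b \<le> x \<longrightarrow> b = x"
    using finite_has_maximal[OF assms(1,2)] by auto
  \<comment> \<open>In a chain a minimal element is comparable to every other one, hence least;
    dually for a maximal one.\<close>
  have "C \<subseteq> {a..b}"
    using a b assms(3) unfolding chain_def by fastforce
  then show thesis
    using a b that by blast
qed

lemma rank_inv_spread_rep_chain:
  assumes "poset_convex J" and "a \<in> C" "b \<in> C" "C \<subseteq> {a..b}"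
  shows "rank_inv ((*) :: 'k::field \<Rightarrow> 'k \<Rightarrow> 'k) (spread_rep J) a b = (if C \<subseteq> J then 1 else 0)"
proof -
  have "a \<in> J \<and> b \<in> J \<longleftrightarrow> C \<subseteq> J"
    using assms unfolding poset_convex_def by (meson atLeastAtMost_iff subset_iff)
  moreover have "a \<le> b"
    using assms by auto
  ultimately show ?thesis
    by (simp add: rank_inv_spread_rep)
qed

text \<open>Summing over all chains of the poset makes the index set independent of
  \<open>J\<close>, so that sums over different \<open>J\<close> can be interchanged.\<close>

lemma euler_char_order_complex_indicator:
  fixes J :: "'p::{finite,order} set"
  shows "euler_char (order_complex J) =
    (\<Sum>C\<in>order_complex UNIV. (- 1) ^ (card C - 1) * (if C \<subseteq> J then 1 else 0))"
proof -
  have "order_complex J = {C \<in> order_complex UNIV. C \<subseteq> J}"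
    by (auto simp: order_complex_def)
  then have "euler_char (order_complex J) =
      (\<Sum>C\<in>order_complex UNIV. if C \<subseteq> J then (- 1) ^ (card C - 1) else 0)"
    by (simp only: euler_char_def sum.inter_filter finite)
  then show ?thesis
    by (simp add: if_distrib cong: if_cong)
qed

text \<open>Adding or removing the apex \<open>x\<close> pairs simplices of opposite sign. Only
  \<open>{x}\<close> stays unpaired, since its partner would be the empty set; it contributes
  1.\<close>

lemma euler_char_order_complex_least:
  fixes J :: "'p::order set"
  assumes "finite J" and x: "x \<in> J" "\<And>y. y \<in> J \<Longrightarrow> x \<le> y"
  shows "euler_char (order_complex J) = 1"
proof -
  let ?s = "\<lambda>C :: 'p set. (- 1 :: int) ^ (card C - 1)"
  \<comment> \<open>\<open>D\<close> is the base of the cone. The empty set is adjoined to it below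
    so that \<open>insert x\<close> also yields the vertex \<open>{x}\<close>.\<close>
  define D where "D = {C \<in> order_complex J. x \<notin> C}"
  have fin: "finite D"
    using assms(1) finite_subset[of "order_complex J" "Pow J"]
    by (auto simp: D_def order_complex_def)
  have "C \<in> insert x ` insert {} D" if "C \<in> order_complex J" "x \<in> C" for C
  proof
    show "C = insert x (C - {x})"
      using that by auto
    show "C - {x} \<in> insert {} D"
      using that by (auto simp: D_def order_complex_def chain_def)
  qed
  moreover have "insert x C \<in> order_complex J" if "C \<in> insert {} D" for C
    using that x by (auto simp: D_def order_complex_def chain_def)
  ultimately have eq: "order_complex J = D \<union> insert x ` insert {} D"
    by (auto simp: D_def)
  have "inj_on (insert x) (insert {} D)"
    by (auto simp: inj_on_def D_def dest: insert_ident)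
  then have "sum ?s (insert x ` insert {} D) = (\<Sum>C\<in>insert {} D. ?s (insert x C))"
    by (simp only: sum.reindex comp_def)
  also have "\<dots> = 1 + (\<Sum>C\<in>D. ?s (insert x C))"
    using fin by (subst sum.insert) (auto simp: D_def order_complex_def)
  also have "(\<Sum>C\<in>D. ?s (insert x C)) = (\<Sum>C\<in>D. - ?s C)"
  proof (rule sum.cong)
    fix C assume "C \<in> D"
    then have "finite C" "C \<noteq> {}" "x \<notin> C"
      by (auto simp: D_def order_complex_def)
    \<comment> \<open>As \<open>card C\<close> is positive, the subtraction
      \<open>card C - 1\<close> is not truncated and the exponent grows by exactly one.\<close>
    then show "?s (insert x C) = - ?s C"
      by (cases "card C") auto
  qed simp
  finally have "sum ?s (insert x ` insert {} D) = 1 - sum ?s D"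
    by (simp add: sum_negf)
  moreover have "euler_char (order_complex J) = sum ?s D + sum ?s (insert x ` insert {} D)"
    unfolding euler_char_def eq using fin by (subst sum.union_disjoint) (auto simp: D_def)
  ultimately show ?thesis
    by simp
qed

lemma euler_char_order_complex_segment:
  fixes J :: "'p::{finite,order} set"
  assumes "J \<in> segments"
  shows "euler_char (order_complex J) = 1"
proof -
  obtain x y where "x \<le> y" "J = {x..y}"
    using assms by (auto simp: segments_def)
  then show ?thesis
    by (intro euler_char_order_complex_least[of J x]) auto
qed

lemma signed_barcode_total_eq_euler_char:
  fixes I :: "'p::{finite,order} set"
  assumes "poset_convex I"
    and c: "is_signed_barcode ((*) :: 'k::field \<Rightarrow> 'k \<Rightarrow> 'k) (spread_rep I) c"
  shows "(\<Sum>J\<in>segments. c J) = euler_char (order_complex I)"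
proof -
  let ?s = "\<lambda>C :: 'p set. (- 1 :: int) ^ (card C - 1)"
  let ?i = "\<lambda>C J :: 'p set. if C \<subseteq> J then 1 else 0 :: int"
  \<comment> \<open>This is the barcode equation at the segment spanned by \<open>C\<close>: both
    \<open>I\<close> and all segments are convex, so each rank there becomes an indicator of
    containing \<open>C\<close>.\<close>
  have ind: "?i C I = (\<Sum>J\<in>segments. c J * ?i C J)" if C: "C \<in> order_complex UNIV" for C
  proof -
    obtain a b where ab: "a \<in> C" "b \<in> C" "C \<subseteq> {a..b}"
      using C finite_chain_has_bounds[of C] by (auto simp: order_complex_def)
    note rank = rank_inv_spread_rep_chain[OF _ ab, where 'k = 'k]
    have "a \<le> b"
      using ab by auto
    then have "int (rank_inv ((*) :: 'k \<Rightarrow> 'k \<Rightarrow> 'k) (spread_rep I) a b) =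
        (\<Sum>J\<in>segments. c J * int (rank_inv ((*) :: 'k \<Rightarrow> 'k \<Rightarrow> 'k) (spread_rep J) a b))"
      using c by (simp add: is_signed_barcode_def)
    also have "\<dots> = (\<Sum>J\<in>segments. c J * ?i C J)"
      by (rule sum.cong) (simp_all add: rank poset_convex_segment)
    finally show ?thesis
      by (simp add: rank[OF assms(1)] split: if_splits)
  qed
  have "euler_char (order_complex I) =
      (\<Sum>C\<in>order_complex UNIV. \<Sum>J\<in>segments. c J * (?s C * ?i C J))"
    unfolding euler_char_order_complex_indicator[of I]
    by (rule sum.cong) (simp_all only: ind sum_distrib_left mult.left_commute)
  also have "\<dots> = (\<Sum>J\<in>segments. c J * euler_char (order_complex J))"
    by (subst sum.swap) (simp only: euler_char_order_complex_indicator sum_distrib_left)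
  also have "\<dots> = (\<Sum>J\<in>segments. c J)"
    by (simp add: euler_char_order_complex_segment)
  finally show ?thesis
    by simp
qed

theorem theorem4p4:
  fixes I :: "'p::{finite,lattice} set"
  assumes "spread I"
  shows "N_sign_barc ((*) :: 'k::field \<Rightarrow> 'k \<Rightarrow> 'k) (spread_rep I) = euler_char (order_complex I)"
proof -
  \<comment> \<open>The barcode is a definite description, so its equations come from existence and
    uniqueness of the coefficients.\<close>
  have "is_signed_barcode ((*) :: 'k \<Rightarrow> 'k \<Rightarrow> 'k) (spread_rep I)
      (signed_barcode ((*) :: 'k \<Rightarrow> 'k \<Rightarrow> 'k) (spread_rep I))"
    unfolding signed_barcode_def by (rule theI'[OF ex1_signed_barcode])
  then show ?thesis
    using assms by (simp add: N_sign_barc_def signed_barcode_total_eq_euler_char spread_def)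
qed

end
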